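(* Let $(X,\mathcal{B},\mu,T)$ be an ergodic measure theoretical dynamical system and let $\mathcal{U}$ be a cover of $X$. Then for any $0<\epsilon<1$ the sequence $\frac{1}{n}\log\mathcal{N}(\mathcal{U}_0^{n-1},\epsilon)$ converges as $n\to\infty$, and the limit is independent of $\epsilon$.
   Context: A measure theoretical dynamical system is a four-tuple $(X,\mathcal{B},\mu,T)$, where $(X,\mathcal{B})$ is a standard space (i.e. isomorphic to $[0,1]$ with the Borel $\sigma$-algebra), $\mu$ is a probability measure on $(X,\mathcal{B})$ and $T$ is an invertible measure preserving transformation of $X$. A cover of $X$ is a finite collection of measurable sets whose union is $X$. For a cover $\mathcal{U}$ and $k\in\mathbb{Z}$, $T^k(\mathcal{U})$ is the cover with elements $T^k(U)$, $U\in\mathcal{U}$. The join $\mathcal{U}\vee\mathcal{V}$ of two covers is the cover whose elements are the sets $U\cap V$ with $U\in\mathcal{U}$, $V\in\mathcal{V}$. We write $\mathcal{U}_0^{n-1}=\mathcal{U}\vee T^{-1}(\mathcal{U})\vee\dots\vee T^{-(n-1)}(\mathcal{U})$. For a cover $\mathcal{V}$ and $0<\epsilon<1$, $\mathcal{N}(\mathcal{V},\epsilon)$ is the minimum number of elements of $\mathcal{V}$ needed to cover $X$ up to a set of $\mu$-measure less than $\epsilon$. *)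

theory Defs
  imports "HOL-Probability.Probability"
begin

definition standard_space :: "'a measure \<Rightarrow> bool" where
  "standard_space M \<longleftrightarrow>
     (\<exists>f g. f \<in> M \<rightarrow>\<^sub>M restrict_space borel {0..1::real} \<and>
            g \<in> restrict_space borel {0..1::real} \<rightarrow>\<^sub>M M \<and>
            (\<forall>x\<in>space M. g (f x) = x) \<and> (\<forall>y\<in>{0..1}. f (g y) = y))"

text \<open>
  Only the values of \<^term>\<open>T\<close> on \<^term>\<open>space M\<close> matter, so its inverse is
  \<^term>\<open>the_inv_into (space M) T\<close> rather than \<^term>\<open>inv T\<close>.
\<close>

locale mt_dynamical_system = prob_space M for M :: "'a measure" +
  fixes T :: "'a \<Rightarrow> 'a"
  assumes standard: "standard_space M"
    and bij_T: "bij_betw T (space M) (space M)"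
    and measurable_T: "T \<in> M \<rightarrow>\<^sub>M M"
    and measurable_inv_T: "the_inv_into (space M) T \<in> M \<rightarrow>\<^sub>M M"
    and measure_preserving_T: "distr M M T = M"

locale ergodic_mt_dynamical_system = mt_dynamical_system +
  assumes ergodic: "A \<in> sets M \<Longrightarrow> T -` A \<inter> space M = A \<Longrightarrow> prob A = 0 \<or> prob A = 1"

definition is_cover :: "'a measure \<Rightarrow> 'a set set \<Rightarrow> bool" where
  "is_cover M \<U> \<longleftrightarrow> finite \<U> \<and> \<U> \<subseteq> sets M \<and> \<Union>\<U> = space M"

definition cover_join :: "'a set set \<Rightarrow> 'a set set \<Rightarrow> 'a set set" where
  "cover_join \<U> \<V> = {U \<inter> V | U V. U \<in> \<U> \<and> V \<in> \<V>}"

definition int_iterate :: "'a measure \<Rightarrow> ('a \<Rightarrow> 'a) \<Rightarrow> int \<Rightarrow> 'a \<Rightarrow> 'a" where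
  "int_iterate M T k =
     (if 0 \<le> k then T ^^ nat k else the_inv_into (space M) T ^^ nat (- k))"

definition cover_image :: "'a measure \<Rightarrow> ('a \<Rightarrow> 'a) \<Rightarrow> int \<Rightarrow> 'a set set \<Rightarrow> 'a set set" where
  "cover_image M T k \<U> = (\<lambda>U. int_iterate M T k ` U) ` \<U>"

text \<open>
  The argument \<open>m\<close> is the last index: \<open>iterated_join M T \<U> m\<close> is the join of
  \<open>T\<^sup>-\<^sup>i(\<U>)\<close> over \<open>0 \<le> i \<le> m\<close>, i.e. \<open>\<U>\<close> from \<open>0\<close> to \<open>m\<close>.
\<close>

primrec iterated_join :: "'a measure \<Rightarrow> ('a \<Rightarrow> 'a) \<Rightarrow> 'a set set \<Rightarrow> nat \<Rightarrow> 'a set set" where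
  "iterated_join M T \<U> 0 = \<U>"
| "iterated_join M T \<U> (Suc m) =
     cover_join (iterated_join M T \<U> m) (cover_image M T (- int (Suc m)) \<U>)"

definition cover_number :: "'a measure \<Rightarrow> 'a set set \<Rightarrow> real \<Rightarrow> nat" where
  "cover_number M \<V> \<epsilon> =
     (LEAST k. \<exists>\<W>\<subseteq>\<V>. finite \<W> \<and> card \<W> = k \<and> measure M (space M - \<Union>\<W>) < \<epsilon>)"

end

theory Submission
  imports Defs "HOL-Real_Asymp.Real_Asymp"
begin

text \<open>
  An element of the join from \<open>0\<close> to \<open>n - 1\<close> is the cell of a word of length \<open>n\<close> over the
  alphabet \<open>\<U>\<close>: the points whose first \<open>n\<close> iterates lie in the successive letters. A covering
  number is therefore the least number of words that name the orbits of all points outside a set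
  of probability less than \<open>\<epsilon>\<close>. Everything follows from one comparison (\<open>covnum_growth\<close>): if
  \<open>N(n, \<epsilon>) \<le> exp (a n)\<close> for infinitely many \<open>n\<close>, then \<open>N(n, \<epsilon>') \<le> exp (b n)\<close> for all large
  \<open>n\<close>, for every \<open>b > a\<close> and every \<open>\<epsilon>'\<close>. Hence the lower limit of the rates for one error
  dominates the upper limit of the rates for every other error, and all of them are equal.

  For the comparison, take for each of these infinitely many \<open>n\<close> an economical family of
  \<open>n\<close>-blocks whose cells have union \<open>B n\<close> of probability at least \<open>1 - \<epsilon>\<close>. The points that lie in
  infinitely many \<open>B n\<close> form a set of positive probability, so by ergodicity almost every orbit
  enters it (\<open>prob_visits\<close>), and outside a set of small probability it does so within a bounded
  time \<open>L\<close>. This bound is fixed first; afterwards finitely many block lengths are selected, all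
  so much longer than \<open>L\<close> that waiting for a block costs a negligible fraction of time
  (\<open>block_scales\<close>). By Markov's inequality and invariance of the measure, most points have few
  bad times along a long orbit, a bad time being one from which no block begins within \<open>L\<close> steps
  (\<open>prob_frequent_visits_le\<close>). Reading such an orbit from left to right cuts its name into
  blocks and a small proportion of single letters (\<open>parse_orbit\<close>). The number of words of this
  form grows only slightly faster than \<open>exp (a n)\<close>: long blocks satisfy a Kraft inequality, and
  each single letter costs a constant factor fixed in advance (\<open>card_parsed_le\<close>).
\<close>

section \<open>Counting words assembled from blocks\<close>

text \<open>
  The number \<open>k\<close> is a budget of single letters rather than their exact number; this makes the
  predicate monotone in \<open>k\<close>.
\<close>

inductive parsed :: "'b set \<Rightarrow> 'b list set \<Rightarrow> nat \<Rightarrow> 'b list \<Rightarrow> bool" for A C where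
  Nil: "parsed A C k []"
| letter: "a \<in> A \<Longrightarrow> parsed A C k w \<Longrightarrow> parsed A C (Suc k) (a # w)"
| block: "c \<in> C \<Longrightarrow> parsed A C k w \<Longrightarrow> parsed A C k (c @ w)"

lemma parsed_mono: "parsed A C k w \<Longrightarrow> k \<le> l \<Longrightarrow> parsed A C l w"
proof (induction arbitrary: l rule: parsed.induct)
  case (letter a k w)
  then obtain l' where "l = Suc l'" "k \<le> l'" by (cases l) auto
  with letter show ?case by (auto intro: parsed.letter)
qed (auto intro: parsed.intros)

lemma parsed_letters: "set u \<subseteq> A \<Longrightarrow> parsed A C k w \<Longrightarrow> parsed A C (length u + k) (u @ w)"
  by (induction u) (auto intro: parsed.letter)

text \<open>
  Removing the first letter or the first block of a word bounds the number \<open>F N k\<close> of these words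
  recursively by \<open>card A * F (N - 1) (k - 1) + (\<Sum>c\<in>C. F (N - length c) k)\<close>. The weight
  \<open>v ^ k * exp (b * N)\<close> majorizes the recursion because each of the two summands receives at
  most half of it: the letters by the choice of \<open>v\<close>, the blocks by Kraft's inequality. Paying
  \<open>v\<close> per letter avoids counting the possible positions of the blocks.
\<close>

lemma card_parsed_le:
  fixes b v :: real
  assumes A: "finite A" and C: "finite C" "[] \<notin> C" and v: "1 \<le> v"
    and letters: "real (card A) * exp (- b) \<le> v / 2"
    and kraft: "(\<Sum>c\<in>C. exp (- b * real (length c))) \<le> 1 / 2"
  shows "finite {w. length w = N \<and> parsed A C k w} \<and>
    real (card {w. length w = N \<and> parsed A C k w}) \<le> v ^ k * exp (b * real N)"
proof (induction N arbitrary: k rule: less_induct)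
  case (less N)
  define F where "F n l = {w. length w = n \<and> parsed A C l w}" for n l
  have fin: "finite (F n l)" and bound: "real (card (F n l)) \<le> v ^ l * exp (b * real n)"
    if "n < N" for n l
    using less.IH[OF that] unfolding F_def by auto
  show ?case
  proof (cases "N = 0")
    case True
    have "{w. length w = N \<and> parsed A C k w} = {[]}"
      using True by (auto intro: parsed.Nil)
    then show ?thesis using v True by (simp add: one_le_power)
  next
    case False
    define P where "P = (if k = 0 then {} else (\<Union>a\<in>A. (#) a ` F (N - 1) (k - 1)))"
    define Q where "Q = (\<Union>c\<in>{c\<in>C. length c \<le> N}. (@) c ` F (N - length c) k)"
    have sub: "F N k \<subseteq> P \<union> Q"
    proof
      fix w assume "w \<in> F N k"
      then have len: "length w = N" and "parsed A C k w" by (auto simp: F_def)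
      from this(2) show "w \<in> P \<union> Q"
      proof cases
        case (letter a l u)
        then have "u \<in> F (N - 1) (k - 1)" using len by (auto simp: F_def)
        then show ?thesis using letter by (auto simp: P_def)
      next
        case (block c u)
        then have "c \<in> {c\<in>C. length c \<le> N}" "u \<in> F (N - length c) k"
          using len by (auto simp: F_def)
        then show ?thesis using block unfolding Q_def by blast
      qed (use len False in simp)
    qed
    have short: "N - length c < N" if "c \<in> C" for c
      using that C False by (cases c) auto
    have finP: "finite P" using A fin False by (auto simp: P_def)
    have finQ: "finite Q" using C fin short by (auto simp: Q_def)
    have cP: "real (card P) \<le> v ^ k * exp (b * real N) / 2"
    proof (cases k)
      case 0
      then show ?thesis by (simp add: P_def)
    next
      case (Suc l)
      have "card P \<le> (\<Sum>a\<in>A. card ((#) a ` F (N - 1) l))"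
        unfolding P_def Suc using A by (simp add: card_UN_le)
      also have "\<dots> \<le> (\<Sum>a\<in>A. card (F (N - 1) l))"
        by (intro sum_mono card_image_le fin) (use False in auto)
      finally have "real (card P) \<le> real (card A) * real (card (F (N - 1) l))"
        by (simp flip: of_nat_mult)
      also have "\<dots> \<le> real (card A) * (v ^ l * exp (b * real (N - 1)))"
        by (intro mult_left_mono bound) (use False in auto)
      also have "exp (b * real (N - 1)) = exp (- b) * exp (b * real N)"
        using False by (simp add: of_nat_diff algebra_simps flip: exp_add)
      also have "real (card A) * (v ^ l * (exp (- b) * exp (b * real N)))
          = (real (card A) * exp (- b)) * (v ^ l * exp (b * real N))" by simp
      also have "\<dots> \<le> (v / 2) * (v ^ l * exp (b * real N))"
        using letters v by (intro mult_right_mono) auto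
      finally show ?thesis by (simp add: Suc)
    qed
    have "card Q \<le> (\<Sum>c\<in>{c\<in>C. length c \<le> N}. card ((@) c ` F (N - length c) k))"
      unfolding Q_def using C by (intro card_UN_le) simp
    also have "\<dots> \<le> (\<Sum>c\<in>{c\<in>C. length c \<le> N}. card (F (N - length c) k))"
      by (intro sum_mono card_image_le fin short) simp
    finally have "real (card Q) \<le> (\<Sum>c\<in>{c\<in>C. length c \<le> N}. real (card (F (N - length c) k)))"
      by (simp flip: of_nat_sum)
    also have "\<dots> \<le> (\<Sum>c\<in>{c\<in>C. length c \<le> N}. v ^ k * exp (b * real N) * exp (- b * real (length c)))"
    proof (rule sum_mono)
      fix c assume c: "c \<in> {c\<in>C. length c \<le> N}"
      have "real (card (F (N - length c) k)) \<le> v ^ k * exp (b * real (N - length c))"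
        using c by (intro bound short) simp
      also have "exp (b * real (N - length c)) = exp (b * real N) * exp (- b * real (length c))"
        using c by (simp add: of_nat_diff algebra_simps flip: exp_add)
      finally show "real (card (F (N - length c) k)) \<le> v ^ k * exp (b * real N) * exp (- b * real (length c))"
        by simp
    qed
    also have "\<dots> \<le> (\<Sum>c\<in>C. v ^ k * exp (b * real N) * exp (- b * real (length c)))"
      using C v by (intro sum_mono2) auto
    also have "\<dots> = v ^ k * exp (b * real N) * (\<Sum>c\<in>C. exp (- b * real (length c)))"
      by (simp add: sum_distrib_left)
    also have "\<dots> \<le> v ^ k * exp (b * real N) * (1 / 2)"
      using v kraft by (intro mult_left_mono) auto
    finally have cQ: "real (card Q) \<le> v ^ k * exp (b * real N) / 2" by simp
    have "card (F N k) \<le> card P + card Q"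
      using card_mono[OF _ sub] card_Un_le[of P Q] finP finQ by simp
    with cP cQ finite_subset[OF sub] finP finQ show ?thesis
      unfolding F_def by simp
  qed
qed

section \<open>Visits to a set of positive measure\<close>

context mt_dynamical_system
begin

lemma T_space: "x \<in> space M \<Longrightarrow> T x \<in> space M"
  using measurable_T by (rule measurable_space)

lemma T_pow_space: "x \<in> space M \<Longrightarrow> (T ^^ i) x \<in> space M"
  by (induction i) (auto simp: T_space)

lemma measurable_T_pow [measurable]: "T ^^ i \<in> M \<rightarrow>\<^sub>M M"
  by (rule measurable_compose_n[OF measurable_T])

lemma distr_T_pow: "distr M M (T ^^ i) = M"
proof (induction i)
  case 0
  show ?case by (simp add: id_def distr_id)
next
  case (Suc i)
  have "distr M M (T ^^ Suc i) = distr (distr M M (T ^^ i)) M T"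
    by (subst distr_distr) (auto simp: measurable_T)
  also have "\<dots> = M" unfolding Suc by (rule measure_preserving_T)
  finally show ?case .
qed

lemma prob_T_pow_vimage:
  assumes "A \<in> sets M"
  shows "prob ((T ^^ i) -` A \<inter> space M) = prob A"
  using measure_distr[OF measurable_T_pow assms, of i] by (simp add: distr_T_pow)

end

context ergodic_mt_dynamical_system
begin

text \<open>
  The set \<open>H 0\<close> of points that ever visit \<open>G\<close> need not be strictly invariant, since a point of
  \<open>G\<close> may never return. The set of points that visit \<open>G\<close> infinitely often is, and it has the
  same probability: it is the decreasing intersection of the preimages \<open>H n\<close> of \<open>H 0\<close> under
  \<open>T ^^ n\<close>, which all have the probability of \<open>H 0\<close>.
\<close>

lemma prob_visits:
  assumes G [measurable]: "G \<in> sets M" and pos: "prob G > 0"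
  shows "prob (\<Union>m. (T ^^ m) -` G \<inter> space M) = 1"
proof -
  define H where "H n = (\<Union>m\<in>{n..}. (T ^^ m) -` G \<inter> space M)" for n
  have [measurable]: "H n \<in> sets M" for n unfolding H_def by measurable
  have H_iff: "x \<in> H n \<longleftrightarrow> x \<in> space M \<and> (\<exists>m\<ge>n. (T ^^ m) x \<in> G)" for x n
    by (auto simp: H_def)
  have "x \<in> H n \<longleftrightarrow> x \<in> (T ^^ n) -` H 0 \<inter> space M" for x n
  proof -
    have shift: "(T ^^ (n + m)) x = (T ^^ m) ((T ^^ n) x)" for m
      by (simp add: add.commute[of n] funpow_add)
    show ?thesis
      unfolding H_iff Int_iff vimage_eq shift[symmetric]
      using T_pow_space[of x n] le_add1 le_Suc_ex by (metis le0)
  qed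
  then have shifted: "(T ^^ n) -` H 0 \<inter> space M = H n" for n by blast
  define p where "p = prob (H 0)"
  have const: "prob (H n) = p" for n
    using prob_T_pow_vimage[of "H 0" n] unfolding shifted p_def by simp
  have dec: "decseq H" unfolding H_def decseq_def by force
  have "(\<lambda>n. prob (H n)) \<longlonglongrightarrow> prob (\<Inter>n. H n)"
    by (rule finite_Lim_measure_decseq) (use dec in auto)
  then have lim: "prob (\<Inter>n. H n) = prob (H 0)"
    by (simp add: const LIMSEQ_const_iff)
  have "G \<subseteq> H 0" using sets.sets_into_space[OF G] by (auto simp: H_def intro!: exI[of _ 0])
  then have "prob G \<le> prob (H 0)" by (intro finite_measure_mono) auto
  moreover have "prob (\<Inter>n. H n) = 0 \<or> prob (\<Inter>n. H n) = 1"
  proof (rule ergodic)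
    show "(\<Inter>n. H n) \<in> sets M" by measurable
    have "x \<in> T -` H n \<inter> space M \<longleftrightarrow> x \<in> H (Suc n)" for x n
    proof -
      have shift: "(T ^^ m) (T x) = (T ^^ Suc m) x" for m
        by (simp only: funpow_Suc_right o_apply)
      show ?thesis
        unfolding H_iff Int_iff vimage_eq shift
        by (metis T_space Suc_le_D Suc_le_mono)
    qed
    then have "T -` H n \<inter> space M = H (Suc n)" for n by blast
    then have "T -` (\<Inter>n. H n) \<inter> space M = (\<Inter>n. H (Suc n))" by blast
    also have "\<dots> = (\<Inter>n. H n)"
      using dec unfolding decseq_Suc_iff by blast
    finally show "T -` (\<Inter>n. H n) \<inter> space M = (\<Inter>n. H n)" .
  qed
  ultimately show ?thesis using lim pos by (simp add: H_def atLeast_0)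
qed

end


section \<open>Orbit names and covering numbers\<close>

primrec cell :: "'a measure \<Rightarrow> ('a \<Rightarrow> 'a) \<Rightarrow> 'a set list \<Rightarrow> 'a set" where
  "cell M T [] = space M"
| "cell M T (A # w) = A \<inter> (T -` cell M T w \<inter> space M)"

definition words :: "'b set \<Rightarrow> nat \<Rightarrow> 'b list set" where
  "words A n = {w. set w \<subseteq> A \<and> length w = n}"

lemma finite_words: "finite A \<Longrightarrow> finite (words A n)"
  unfolding words_def by (rule finite_lists_length_eq)

lemma card_words: "finite A \<Longrightarrow> card (words A n) = card A ^ n"
  unfolding words_def by (rule card_lists_length_eq)

lemma parsed_in_lists:
  "parsed A C k w \<Longrightarrow> (\<And>c. c \<in> C \<Longrightarrow> set c \<subseteq> A) \<Longrightarrow> set w \<subseteq> A"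
  by (induction rule: parsed.induct) auto

context mt_dynamical_system
begin

lemma cell_append:
  "x \<in> space M \<Longrightarrow> x \<in> cell M T (u @ w) \<longleftrightarrow> x \<in> cell M T u \<and> (T ^^ length u) x \<in> cell M T w"
proof (induction u arbitrary: x)
  case (Cons A u)
  have "(T ^^ length u) (T x) = (T ^^ length (A # u)) x"
    by (simp only: funpow_Suc_right o_apply list.size add_0_right add_Suc_right One_nat_def)
  with Cons.IH[of "T x"] Cons.prems T_space[of x] show ?case by (simp del: funpow.simps)
qed simp

lemma sets_cell: "set w \<subseteq> sets M \<Longrightarrow> cell M T w \<in> sets M"
proof (induction w)
  case (Cons A w)
  then show ?case using measurable_sets[OF measurable_T, of "cell M T w"]
    by (auto intro!: sets.Int)
qed simp

lemma cell_subset_space: "cell M T w \<subseteq> space M"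
  by (induction w) auto

text \<open>
  The covers \<open>T\<^sup>-\<^sup>i(\<U>)\<close> consist of images under iterates of the inverse; as preimages under
  iterates of \<open>T\<close> they fit the recursion of \<open>cell\<close>.
\<close>

lemma inverse_iterate_image:
  assumes "A \<subseteq> space M"
  shows "(the_inv_into (space M) T ^^ i) ` A = (T ^^ i) -` A \<inter> space M"
proof (induction i)
  case 0
  show ?case using assms by auto
next
  case (Suc i)
  let ?S = "the_inv_into (space M) T"
  have inj: "inj_on T (space M)" and surj: "T ` space M = space M"
    using bij_T by (auto simp: bij_betw_def)
  have ST: "?S (T x) = x" if "x \<in> space M" for x
    using the_inv_into_f_f[OF inj that] .
  have TS: "T (?S y) = y" "?S y \<in> space M" if "y \<in> space M" for y
    using f_the_inv_into_f[OF inj, of y] the_inv_into_into[OF inj, of y "space M"] surj that by auto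
  have "(?S ^^ Suc i) ` A = ?S ` ((T ^^ i) -` A \<inter> space M)"
    by (simp add: image_comp[symmetric] Suc.IH del: o_apply)
  also have "\<dots> = T -` ((T ^^ i) -` A \<inter> space M) \<inter> space M"
  proof (intro equalityI subsetI)
    fix x assume "x \<in> T -` ((T ^^ i) -` A \<inter> space M) \<inter> space M"
    then show "x \<in> ?S ` ((T ^^ i) -` A \<inter> space M)"
      by (intro image_eqI[of _ _ "T x"]) (auto simp: ST)
  qed (auto simp: TS)
  also have "\<dots> = (T ^^ Suc i) -` A \<inter> space M"
    using T_space by (auto simp: funpow_swap1)
  finally show ?case .
qed

end

locale covered_system = mt_dynamical_system +
  fixes \<U> :: "'a set set"
  assumes cover: "is_cover M \<U>"
begin

lemma finite_cover: "finite \<U>" and cover_sets: "\<U> \<subseteq> sets M" and cover_Union: "\<Union>\<U> = space M"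
  using cover by (auto simp: is_cover_def)

lemma sets_cell_words: "w \<in> words \<U> n \<Longrightarrow> cell M T w \<in> sets M"
  using cover_sets by (auto simp: words_def intro: sets_cell)

lemma card_cover_ge_1: "1 \<le> card \<U>"
proof -
  have "\<U> \<noteq> {}" using cover_Union not_empty by auto
  then show ?thesis using finite_cover by (simp add: Suc_le_eq card_gt_0_iff)
qed

text \<open>
  The join appends its last factor on the right, whereas \<open>cell\<close> recurses from the left.
\<close>

lemma iterated_join_eq_cells: "iterated_join M T \<U> m = cell M T ` words \<U> (Suc m)"
proof (induction m)
  case 0
  have "words \<U> (Suc 0) = (\<lambda>A. [A]) ` \<U>"
    by (auto simp: words_def length_Suc_conv)
  moreover have "cell M T [A] = A" if "A \<in> \<U>" for A
    using that cover_Union T_space by auto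
  ultimately show ?case by (simp add: image_comp cong: image_cong)
next
  case (Suc m)
  have last: "cell M T (w @ [A]) = cell M T w \<inter> ((T ^^ Suc m) -` A \<inter> space M)"
    if "w \<in> words \<U> (Suc m)" "A \<in> \<U>" for w A
  proof -
    have "x \<in> cell M T (w @ [A]) \<longleftrightarrow> x \<in> cell M T w \<and> (T ^^ Suc m) x \<in> A" if "x \<in> space M" for x
      using cell_append[OF that, of w "[A]"] T_pow_space[OF that, of "Suc m"] \<open>w \<in> _\<close> T_space
      by (simp add: words_def)
    then show ?thesis using cell_subset_space by blast
  qed
  have img: "int_iterate M T (- int (Suc m)) ` A = (T ^^ Suc m) -` A \<inter> space M" if "A \<in> \<U>" for A
  proof -
    have "A \<subseteq> space M" using that cover_Union by blast
    then show ?thesis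
      using inverse_iterate_image[of A "Suc m"]
      by (simp add: int_iterate_def nat_add_distrib del: funpow.simps)
  qed
  have image: "cover_image M T (- int (Suc m)) \<U> = (\<lambda>A. (T ^^ Suc m) -` A \<inter> space M) ` \<U>"
    unfolding cover_image_def by (rule image_cong[OF refl img])
  have "iterated_join M T \<U> (Suc m) =
      {cell M T w \<inter> ((T ^^ Suc m) -` A \<inter> space M) | w A. w \<in> words \<U> (Suc m) \<and> A \<in> \<U>}"
    unfolding iterated_join.simps Suc cover_join_def image by blast
  also have "\<dots> = {cell M T (w @ [A]) | w A. w \<in> words \<U> (Suc m) \<and> A \<in> \<U>}"
    by (intro Collect_cong ex_cong1) (auto simp only: last)
  also have "\<dots> = cell M T ` words \<U> (Suc (Suc m))"
  proof -
    have "words \<U> (Suc (Suc m)) = {w @ [A] | w A. w \<in> words \<U> (Suc m) \<and> A \<in> \<U>}"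
      by (auto simp: words_def length_Suc_conv_rev)
    then show ?thesis by auto
  qed
  finally show ?case .
qed

abbreviation covnum :: "nat \<Rightarrow> real \<Rightarrow> nat" where
  "covnum n \<epsilon> \<equiv> cover_number M (iterated_join M T \<U> (n - 1)) \<epsilon>"

lemma covnum_le:
  assumes "0 < n" "W \<subseteq> words \<U> n" "prob (space M - \<Union>(cell M T ` W)) < \<epsilon>"
  shows "covnum n \<epsilon> \<le> card W"
proof -
  have fin: "finite W" by (rule finite_subset[OF assms(2) finite_words[OF finite_cover]])
  have "covnum n \<epsilon> \<le> card (cell M T ` W)"
    unfolding cover_number_def
  proof (rule Least_le, intro exI conjI)
    show "cell M T ` W \<subseteq> iterated_join M T \<U> (n - 1)"
      using assms(1,2) by (simp add: iterated_join_eq_cells image_mono)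
  qed (use assms(3) fin in simp_all)
  also have "\<dots> \<le> card W" using fin by (rule card_image_le)
  finally show ?thesis .
qed

lemma cells_cover: "(\<Union>w\<in>words \<U> n. cell M T w) = space M"
proof -
  have "\<exists>w\<in>words \<U> n. x \<in> cell M T w" if "x \<in> space M" for x
    using that
  proof (induction n arbitrary: x)
    case 0
    then show ?case by (auto simp: words_def)
  next
    case (Suc n)
    obtain w where "w \<in> words \<U> n" "T x \<in> cell M T w"
      using Suc.IH[OF T_space[OF Suc.prems]] by blast
    moreover obtain A where "A \<in> \<U>" "x \<in> A" using Suc.prems cover_Union by blast
    ultimately have "A # w \<in> words \<U> (Suc n)" "x \<in> cell M T (A # w)"
      using Suc.prems by (auto simp: words_def)
    then show ?case by (rule bexI[rotated])
  qed
  with cell_subset_space show ?thesis by (intro equalityI subsetI) (auto dest: subsetD)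
qed

lemma covnum_attained:
  assumes "0 < n" "0 < \<epsilon>"
  obtains W where "W \<subseteq> words \<U> n" "card W = covnum n \<epsilon>"
    "prob (space M - \<Union>(cell M T ` W)) < \<epsilon>"
proof -
  let ?V = "iterated_join M T \<U> (n - 1)"
  let ?P = "\<lambda>k. \<exists>\<W>\<subseteq>?V. finite \<W> \<and> card \<W> = k \<and> prob (space M - \<Union>\<W>) < \<epsilon>"
  have V: "?V = cell M T ` words \<U> n" using assms by (simp add: iterated_join_eq_cells)
  have "?P (card ?V)"
    using assms finite_words[OF finite_cover] unfolding V
    by (intro exI[of _ "cell M T ` words \<U> n"]) (simp add: cells_cover)
  then have "?P (covnum n \<epsilon>)" unfolding cover_number_def by (rule LeastI)
  then obtain \<W> where \<W>: "\<W> \<subseteq> cell M T ` words \<U> n" "card \<W> = covnum n \<epsilon>"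
    "prob (space M - \<Union>\<W>) < \<epsilon>" unfolding V by blast
  then obtain W where "W \<subseteq> words \<U> n" "\<W> = cell M T ` W" "inj_on (cell M T) W"
    by (auto simp: subset_image_inj)
  with \<W> that show thesis by (simp add: card_image)
qed

lemma covnum_ge_1:
  assumes "0 < n" "0 < \<epsilon>" "\<epsilon> < 1"
  shows "1 \<le> covnum n \<epsilon>"
proof -
  obtain W where W: "W \<subseteq> words \<U> n" "card W = covnum n \<epsilon>"
    "prob (space M - \<Union>(cell M T ` W)) < \<epsilon>" by (rule covnum_attained[OF assms(1,2)])
  have "W \<noteq> {}" using W(3) assms prob_space by auto
  moreover have "finite W" by (rule finite_subset[OF W(1) finite_words[OF finite_cover]])
  ultimately show ?thesis using W(2) 
    unfolding W(2)[symmetric] by (simp add: Suc_le_eq card_gt_0_iff)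
qed

lemma covnum_le_power:
  assumes "0 < n" "0 < \<epsilon>"
  shows "covnum n \<epsilon> \<le> card \<U> ^ n"
  using covnum_le[OF assms(1) order_refl, of \<epsilon>] assms(2)
  by (simp add: cells_cover card_words[OF finite_cover])

text \<open>
  The name of an orbit segment is read greedily. At a time from which no block begins within
  \<open>L\<close> steps, a single letter is read; this is charged to the first summand of the bound on \<open>k\<close>.
  Otherwise at most \<open>L\<close> letters are read and then a block; as blocks have length at least \<open>p\<close>, at
  most \<open>r \<le> N / p\<close> blocks are read. Once the remaining segment may be too short for waiting
  and reading a whole block, which happens at length \<open>L + q\<close>, all of it is read letter by letter.
\<close>

lemma parse_orbit:
  fixes E :: "nat \<Rightarrow> 'a set" and L p q :: nat
  defines "R \<equiv> {x. \<exists>m\<le>L. \<exists>n\<in>{p..q}. (T ^^ m) x \<in> E n}"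
  assumes p: "0 < p"
    and blocks: "\<And>n x. n \<in> {p..q} \<Longrightarrow> x \<in> E n \<Longrightarrow> \<exists>c\<in>C. length c = n \<and> x \<in> cell M T c"
    and x: "x \<in> space M"
  shows "\<exists>w k r. length w = N \<and> x \<in> cell M T w \<and> parsed \<U> C k w \<and>
    k \<le> card {i. i < N \<and> (T ^^ i) x \<notin> R} + L * r + (L + q) \<and> r * p \<le> N"
  using x
proof (induction N arbitrary: x rule: less_induct)
  case (less N)
  define bad where "bad N x = {i. i < N \<and> (T ^^ i) x \<notin> R}" for N x
  have fin: "finite (bad n y)" for n y by (simp add: bad_def)
  have free: "\<exists>w. length w = n \<and> set w \<subseteq> \<U> \<and> x \<in> cell M T w" if "x \<in> space M" for n x
    using cells_cover[of n] that by (auto simp: words_def)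
  \<comment> \<open>Bad times of the orbit after \<open>m\<close> steps and bad times before \<open>m\<close> are counted separately.\<close>
  have bad_le: "card (bad (N - m) ((T ^^ m) x)) + card (bad (min m N) x) \<le> card (bad N x)" for m
  proof -
    have "(+) m ` bad (N - m) ((T ^^ m) x) \<subseteq> bad N x"
      by (auto simp: bad_def add.commute[of m] funpow_add)
    moreover have "bad (min m N) x \<subseteq> bad N x" by (auto simp: bad_def)
    moreover have "(+) m ` bad (N - m) ((T ^^ m) x) \<inter> bad (min m N) x = {}"
      by (auto simp: bad_def)
    ultimately have "card ((+) m ` bad (N - m) ((T ^^ m) x)) + card (bad (min m N) x) \<le> card (bad N x)"
      using fin by (metis card_Un_disjoint card_mono finite_imageI Un_least)
    then show ?thesis by (simp add: card_image)
  qed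
  consider "N \<le> L + q" | "L + q < N" "x \<notin> R" | "L + q < N" "x \<in> R" by linarith
  then show ?case
  proof cases
    case 1
    obtain w where "length w = N" "set w \<subseteq> \<U>" "x \<in> cell M T w" using free[OF less.prems] by blast
    moreover from this have "parsed \<U> C (N + 0) (w @ [])" using parsed_letters parsed.Nil by metis
    ultimately show ?thesis using 1 by (intro exI[of _ w] exI[of _ N] exI[of _ 0]) simp
  next
    case 2
    obtain w k r where w: "length w = N - 1" "T x \<in> cell M T w" "parsed \<U> C k w"
      "k \<le> card (bad (N - 1) (T x)) + L * r + (L + q)" "r * p \<le> N - 1"
      using less.IH[of "N - 1" "T x"] 2 T_space[OF less.prems] unfolding bad_def by auto
    obtain A where A: "A \<in> \<U>" "x \<in> A" using less.prems cover_Union by blast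
    have "bad (min 1 N) x = {0}" using 2 by (auto simp: bad_def)
    then have "card (bad (N - 1) (T x)) + 1 \<le> card (bad N x)" using bad_le[of 1] by simp
    then have "Suc k \<le> card (bad N x) + L * r + (L + q)" using w(4) by linarith
    moreover have "parsed \<U> C (Suc k) (A # w)" using A w(3) by (intro parsed.letter)
    ultimately show ?thesis using w A 2 less.prems
      unfolding bad_def by (intro exI[of _ "A # w"] exI[of _ "Suc k"] exI[of _ r]) auto
  next
    case 3
    then obtain m n where mn: "m \<le> L" "n \<in> {p..q}" "(T ^^ m) x \<in> E n" by (auto simp: R_def)
    obtain c where c: "c \<in> C" "length c = n" "(T ^^ m) x \<in> cell M T c" using blocks[OF mn(2,3)] by blast
    obtain u where u: "length u = m" "set u \<subseteq> \<U>" "x \<in> cell M T u" using free[OF less.prems] by blast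
    define N' y where "N' = N - (m + n)" and "y = (T ^^ (m + n)) x"
    have N': "N = m + n + N'" "N' < N" using mn 3 p by (auto simp: N'_def)
    have y: "y \<in> space M" using T_pow_space[OF less.prems] by (simp add: y_def)
    obtain w k r where w: "length w = N'" "y \<in> cell M T w" "parsed \<U> C k w"
      "k \<le> card (bad N' y) + L * r + (L + q)" "r * p \<le> N'"
      using less.IH[OF N'(2) y] unfolding bad_def by auto
    have "parsed \<U> C (m + k) (u @ c @ w)"
      using u c w parsed_letters parsed.block by metis
    moreover have "x \<in> cell M T (u @ c @ w)"
    proof -
      have "(T ^^ n) ((T ^^ m) x) = y" by (simp add: y_def add.commute[of m] funpow_add)
      then show ?thesis
        using u c w less.prems T_pow_space[OF less.prems, of m] by (simp add: cell_append)
    qed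
    moreover have "m + k \<le> card (bad N x) + L * Suc r + (L + q)"
    proof -
      have "card (bad N' y) \<le> card (bad N x)" using bad_le[of "m + n"] by (simp add: N'_def y_def)
      then show ?thesis using w(4) mn(1) by simp
    qed
    moreover have "Suc r * p \<le> N" using w(5) mn(2) N' by simp
    ultimately show ?thesis using u c w N'
      unfolding bad_def by (intro exI[of _ "u @ c @ w"] exI[of _ "m + k"] exI[of _ "Suc r"]) auto
  qed
qed

end


section \<open>Exponential growth does not depend on the error\<close>

context mt_dynamical_system
begin

text \<open>
  This is Markov's inequality: by invariance, the expected number of visits to \<open>D\<close> during \<open>N\<close>
  steps is \<open>N * prob D\<close>.
\<close>

lemma prob_frequent_visits_le:
  assumes D [measurable]: "D \<in> sets M" and t: "0 < t"
  shows "{x \<in> space M. t \<le> real (card {i. i < N \<and> (T ^^ i) x \<in> D})} \<in> sets M"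
    and "prob {x \<in> space M. t \<le> real (card {i. i < N \<and> (T ^^ i) x \<in> D})} \<le> real N * prob D / t"
proof -
  define f where "f x = (\<Sum>i<N. indicator ((T ^^ i) -` D \<inter> space M) x :: real)" for x
  have f: "f x = real (card {i. i < N \<and> (T ^^ i) x \<in> D})" if "x \<in> space M" for x
  proof -
    have "f x = (\<Sum>i<N. if (T ^^ i) x \<in> D then 1 else 0)"
      unfolding f_def using that by (intro sum.cong) (auto simp: indicator_def)
    also have "\<dots> = real (card {i. i < N \<and> (T ^^ i) x \<in> D})"
      by (simp add: sum.If_cases Int_def)
    finally show ?thesis .
  qed
  have [measurable]: "f \<in> borel_measurable M" unfolding f_def by measurable
  have eq: "{x \<in> space M. t \<le> real (card {i. i < N \<and> (T ^^ i) x \<in> D})} = {x \<in> space M. t \<le> f x}"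
    using f by auto
  show "{x \<in> space M. t \<le> real (card {i. i < N \<and> (T ^^ i) x \<in> D})} \<in> sets M"
    unfolding eq by measurable
  have int: "integrable M f" unfolding f_def by (simp add: emeasure_eq_measure)
  have "expectation f = (\<Sum>i<N. prob ((T ^^ i) -` D \<inter> space M))"
    unfolding f_def by (subst Bochner_Integration.integral_sum) (auto simp: emeasure_eq_measure)
  also have "\<dots> = real N * prob D" by (simp add: prob_T_pow_vimage)
  finally have "expectation f = real N * prob D" .
  moreover have "prob {x \<in> space M. t \<le> f x} \<le> expectation f / t"
    by (rule integral_Markov_inequality_measure[OF int, of "{}"])
      (use t in \<open>auto simp: f_def sum_nonneg\<close>)
  ultimately show "prob {x \<in> space M. t \<le> real (card {i. i < N \<and> (T ^^ i) x \<in> D})} \<le> real N * prob D / t"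
    unfolding eq by simp
qed

end

lemma geometric_segment_le:
  fixes z :: real
  assumes "0 \<le> z" "z < 1"
  shows "(\<Sum>n\<in>{p..q}. z ^ n) \<le> z ^ p / (1 - z)"
proof (cases "p \<le> q")
  case True
  have "(1 - z) * (\<Sum>n\<in>{p..q}. z ^ n) = z ^ p - z ^ Suc q" by (rule sum_gp_multiplied[OF True])
  also have "\<dots> \<le> z ^ p" using assms by simp
  finally show ?thesis using assms by (simp add: field_simps)
qed (use assms in simp)

locale covered_ergodic_system = ergodic_mt_dynamical_system M T + covered_system M T \<U>
  for M :: "'a measure" and T \<U>
begin

text \<open>
  The order of the choices matters. The waiting time \<open>L\<close> is determined by the set \<open>G\<close> of points
  that lie in infinitely many \<open>B n\<close>, before any block length is selected, so the least length \<open>p\<close>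
  may be taken large compared with \<open>L\<close>. Since a point of \<open>G\<close> lies in some \<open>B n\<close> with \<open>n \<ge> p\<close>
  whatever \<open>p\<close> is, a sufficiently large \<open>q\<close> then loses almost nothing.
\<close>

lemma block_scales:
  fixes \<epsilon> \<delta> s z :: real
  assumes \<epsilon>: "\<epsilon> < 1" and \<delta>: "0 < \<delta>" and s: "0 < s" and z: "0 \<le> z" "z < 1"
    and B [measurable]: "\<And>n. B n \<in> sets M"
    and io: "\<And>J. \<exists>n\<ge>J. 1 - \<epsilon> \<le> prob (B n)"
  obtains L p q :: nat where "0 < p" "real L \<le> s * real p" "(\<Sum>n\<in>{p..q}. z ^ n) \<le> 1 / 2"
    "{x \<in> space M. \<exists>m\<le>L. \<exists>n\<in>{p..q}. (T ^^ m) x \<in> B n} \<in> sets M"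
    "1 - \<delta> < prob {x \<in> space M. \<exists>m\<le>L. \<exists>n\<in>{p..q}. (T ^^ m) x \<in> B n}"
proof -
  define U where "U J = (\<Union>n\<in>{J..}. B n)" for J
  have [measurable]: "U J \<in> sets M" for J unfolding U_def by measurable
  have U_ge: "1 - \<epsilon> \<le> prob (U J)" for J
  proof -
    obtain n where "J \<le> n" "1 - \<epsilon> \<le> prob (B n)" using io by blast
    moreover from this have "prob (B n) \<le> prob (U J)"
      by (intro finite_measure_mono) (auto simp: U_def)
    ultimately show ?thesis by linarith
  qed
  define G where "G = (\<Inter>J. U J)"
  have [measurable]: "G \<in> sets M" unfolding G_def by measurable
  have "decseq U" unfolding U_def decseq_def by force
  then have "(\<lambda>J. prob (U J)) \<longlonglongrightarrow> prob G"
    unfolding G_def by (intro finite_Lim_measure_decseq) auto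
  then have "1 - \<epsilon> \<le> prob G" by (rule LIMSEQ_le_const) (use U_ge in blast)
  then have one: "prob (\<Union>m. (T ^^ m) -` G \<inter> space M) = 1"
    using \<epsilon> by (intro prob_visits) auto
  define V where "V L = (\<Union>m\<in>{..L}. (T ^^ m) -` G \<inter> space M)" for L
  have [measurable]: "V L \<in> sets M" for L unfolding V_def by measurable
  have "(\<Union>L. V L) = (\<Union>m. (T ^^ m) -` G \<inter> space M)" by (auto simp: V_def)
  moreover have "(\<lambda>L. prob (V L)) \<longlonglongrightarrow> prob (\<Union>L. V L)"
    by (rule finite_Lim_measure_incseq) (auto simp: V_def incseq_def intro: order_trans)
  ultimately have "(\<lambda>L. prob (V L)) \<longlonglongrightarrow> 1" using one by simp
  then have "\<forall>\<^sub>F L in sequentially. 1 - \<delta> < prob (V L)" by (rule order_tendstoD) (use \<delta> in simp)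
  then obtain L where L: "1 - \<delta> < prob (V L)" by (auto simp: eventually_sequentially)
  have "(\<lambda>p. z ^ p / (1 - z)) \<longlonglongrightarrow> 0 / (1 - z)"
    by (intro tendsto_intros LIMSEQ_power_zero) (use z in auto)
  then have "\<forall>\<^sub>F p in sequentially. z ^ p / (1 - z) < 1 / 2" by (rule order_tendstoD) simp
  moreover have "\<forall>\<^sub>F p in sequentially. real L / s \<le> real p" by real_asymp
  ultimately have "\<forall>\<^sub>F p in sequentially. z ^ p / (1 - z) < 1 / 2 \<and> real L / s \<le> real p \<and> 0 < p"
    using eventually_gt_at_top[of 0] by eventually_elim auto
  then obtain p where p: "z ^ p / (1 - z) < 1 / 2" "real L / s \<le> real p" "0 < p"
    by (auto simp: eventually_sequentially)
  define R where "R q = {x \<in> space M. \<exists>m\<le>L. \<exists>n\<in>{p..q}. (T ^^ m) x \<in> B n}" for q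
  have "R q = (\<Union>m\<in>{..L}. \<Union>n\<in>{p..q}. (T ^^ m) -` B n \<inter> space M)" for q
    by (auto simp: R_def)
  then have [measurable]: "R q \<in> sets M" for q by simp
  have "(\<lambda>q. prob (R q)) \<longlonglongrightarrow> prob (\<Union>q. R q)"
    by (rule finite_Lim_measure_incseq) (auto simp: R_def incseq_def intro: order_trans, fastforce)
  moreover have "prob (V L) \<le> prob (\<Union>q. R q)"
  proof (rule finite_measure_mono)
    show "V L \<subseteq> (\<Union>q. R q)"
    proof
      fix x assume "x \<in> V L"
      then obtain m where "m \<le> L" "x \<in> space M" "(T ^^ m) x \<in> U p" by (auto simp: V_def G_def)
      then obtain n where "p \<le> n" "(T ^^ m) x \<in> B n" by (auto simp: U_def)
      then have "x \<in> R n" using \<open>m \<le> L\<close> \<open>x \<in> space M\<close> by (auto simp: R_def intro!: exI[of _ m])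
      then show "x \<in> (\<Union>q. R q)" by blast
    qed
  qed simp
  ultimately have "\<forall>\<^sub>F q in sequentially. 1 - \<delta> < prob (R q)"
    using L by (auto intro: order_tendstoD)
  then obtain q where q: "1 - \<delta> < prob (R q)" by (auto simp: eventually_sequentially)
  have "(\<Sum>n\<in>{p..q}. z ^ n) \<le> 1 / 2" using geometric_segment_le[OF z, of p q] p(1) by linarith
  moreover have "real L \<le> s * real p" using p(2) s by (simp add: field_simps)
  ultimately show thesis using that[OF p(3)] q \<open>R q \<in> sets M\<close> unfolding R_def by blast
qed

text \<open>
  The gap between \<open>a\<close> and \<open>b\<close> is spent in two halves. Counting blocks at the rate
  \<open>b1 = (a + b) / 2 > a\<close> makes their Kraft sum a tail of a geometric series, and the other half
  pays for the single letters: up to time \<open>N\<close> there are about \<open>2 s N\<close> of them, where \<open>s N\<close>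
  accounts for bad times and another \<open>s N\<close> for waiting before blocks, and each contributes a
  factor \<open>v\<close>.
\<close>

lemma covnum_growth:
  fixes \<epsilon> \<epsilon>' a b :: real
  assumes \<epsilon>: "0 < \<epsilon>" "\<epsilon> < 1" and \<epsilon>': "0 < \<epsilon>'" and ab: "a < b"
    and freq: "\<exists>\<^sub>F n in sequentially. real (covnum n \<epsilon>) \<le> exp (a * real n)"
  shows "\<forall>\<^sub>F n in sequentially. real (covnum n \<epsilon>') \<le> exp (b * real n)"
proof -
  define S where "S = {n. 0 < n \<and> real (covnum n \<epsilon>) \<le> exp (a * real n)}"
  have S_unbounded: "\<exists>n\<ge>J. n \<in> S" for J
  proof -
    obtain n where "Suc J \<le> n" "real (covnum n \<epsilon>) \<le> exp (a * real n)"
      using freq unfolding frequently_sequentially by blast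
    then show ?thesis by (intro exI[of _ n]) (simp add: S_def)
  qed
  have "\<forall>n\<in>S. \<exists>W. W \<subseteq> words \<U> n \<and> card W = covnum n \<epsilon> \<and> prob (space M - \<Union>(cell M T ` W)) < \<epsilon>"
  proof
    fix n assume "n \<in> S"
    then have "0 < n" by (simp add: S_def)
    then show "\<exists>W. W \<subseteq> words \<U> n \<and> card W = covnum n \<epsilon> \<and> prob (space M - \<Union>(cell M T ` W)) < \<epsilon>"
      by (rule covnum_attained[OF _ \<epsilon>(1)]) blast
  qed
  then obtain W where W: "\<And>n. n \<in> S \<Longrightarrow> W n \<subseteq> words \<U> n"
    "\<And>n. n \<in> S \<Longrightarrow> card (W n) = covnum n \<epsilon>"
    "\<And>n. n \<in> S \<Longrightarrow> prob (space M - \<Union>(cell M T ` W n)) < \<epsilon>" by metis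
  \<comment> \<open>Lengths outside \<open>S\<close> contribute no block, so that \<open>C\<close> and \<open>B\<close> are indexed by all
    lengths.\<close>
  define C where "C n = (if n \<in> S then W n else {})" for n
  have C_words: "C n \<subseteq> words \<U> n" for n using W(1) by (auto simp: C_def)
  have C_length: "length c = n" and C_set: "set c \<subseteq> \<U>" if "c \<in> C n" for c n
    using C_words that by (auto simp: words_def)
  have C_fin: "finite (C n)" for n by (rule finite_subset[OF C_words finite_words[OF finite_cover]])
  have C_card: "real (card (C n)) \<le> exp (a * real n)" for n
    using W(2) by (simp add: C_def S_def)
  define B where "B n = \<Union>(cell M T ` C n)" for n
  have B_sets [measurable]: "B n \<in> sets M" for n
    unfolding B_def
    by (intro sets.finite_Union finite_imageI C_fin image_subsetI) (rule sets_cell_words[OF subsetD[OF C_words]])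
  have B_io: "\<exists>n\<ge>J. 1 - \<epsilon> \<le> prob (B n)" for J
  proof -
    obtain n where "n \<ge> J" "n \<in> S" using S_unbounded by blast
    then show ?thesis using W(3)[of n] prob_compl[OF B_sets[of n]] by (intro exI[of _ n]) (auto simp: B_def C_def)
  qed

  \<comment> \<open>The letter cost \<open>v\<close> depends only on \<open>b1\<close> and \<open>\<U>\<close>, so \<open>s\<close> can be chosen small against \<open>1 / ln v\<close>;
    adding 1 in its denominator covers the case \<open>v = 1\<close>.\<close>
  define b1 where "b1 = (a + b) / 2"
  define v where "v = max 1 (2 * (real (card \<U>) * exp (- b1)))"
  define s where "s = (b - b1) / (4 * (ln v + 1))"
  define z where "z = exp (a - b1)"
  have v: "1 \<le> v" "real (card \<U>) * exp (- b1) \<le> v / 2" by (auto simp: v_def)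
  have lnv: "0 \<le> ln v" using v(1) by simp
  have gap: "0 < b - b1" using ab by (simp add: b1_def field_simps)
  have s: "0 < s" using gap lnv by (simp add: s_def)
  have "s * (4 * (ln v + 1)) = b - b1" using lnv by (simp add: s_def)
  then have s_lnv: "2 * s * ln v \<le> (b - b1) / 2" using s by (simp add: algebra_simps)
  have z: "0 \<le> z" "z < 1" using ab by (auto simp: z_def b1_def field_simps)
  \<comment> \<open>Bad times have probability below \<open>s * \<epsilon>'\<close>, hence a proportion \<open>s\<close> of them occurs with
    probability below \<open>\<epsilon>'\<close>.\<close>
  obtain L p q where p: "0 < p" and L: "real L \<le> s * real p"
    and sum_z: "(\<Sum>n\<in>{p..q}. z ^ n) \<le> 1 / 2"
    and R_sets': "{x \<in> space M. \<exists>m\<le>L. \<exists>n\<in>{p..q}. (T ^^ m) x \<in> B n} \<in> sets M"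
    and R_prob': "1 - s * \<epsilon>' < prob {x \<in> space M. \<exists>m\<le>L. \<exists>n\<in>{p..q}. (T ^^ m) x \<in> B n}"
    by (rule block_scales[OF \<epsilon>(2) _ s z B_sets B_io, of "s * \<epsilon>'"]) (use s \<epsilon>' in auto)
  define R where "R = {x. \<exists>m\<le>L. \<exists>n\<in>{p..q}. (T ^^ m) x \<in> B n}"
  define D where "D = space M - R"
  have "D = space M - {x \<in> space M. \<exists>m\<le>L. \<exists>n\<in>{p..q}. (T ^^ m) x \<in> B n}"
    by (auto simp: D_def R_def)
  with R_sets' R_prob' have D_sets: "D \<in> sets M" and D_prob: "prob D < s * \<epsilon>'"
    by (auto simp: prob_compl)

  define blocks where "blocks = (\<Union>n\<in>{p..q}. C n)"
  have blocks: "finite blocks" "[] \<notin> blocks" using C_fin C_length p by (fastforce simp: blocks_def)+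
  have kraft: "(\<Sum>c\<in>blocks. exp (- b1 * real (length c))) \<le> 1 / 2"
  proof -
    have "(\<Sum>c\<in>blocks. exp (- b1 * real (length c))) = (\<Sum>n\<in>{p..q}. \<Sum>c\<in>C n. exp (- b1 * real (length c)))"
      unfolding blocks_def by (rule sum.UNION_disjoint) (use C_fin in \<open>auto dest: C_length\<close>)
    also have "\<dots> = (\<Sum>n\<in>{p..q}. real (card (C n)) * exp (- b1 * real n))"
      by (intro sum.cong refl) (simp add: C_length)
    also have "\<dots> \<le> (\<Sum>n\<in>{p..q}. exp (a * real n) * exp (- b1 * real n))"
      by (intro sum_mono mult_right_mono C_card) simp
    also have "\<dots> = (\<Sum>n\<in>{p..q}. z ^ n)"
      by (simp add: z_def algebra_simps flip: exp_add exp_of_nat_mult)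
    finally show ?thesis using sum_z by simp
  qed
  have blocks_set: "set c \<subseteq> \<U>" if "c \<in> blocks" for c
    using that C_set by (auto simp: blocks_def)

  define K where "K N = nat \<lfloor>2 * s * real N\<rfloor> + (L + q)" for N
  define names where "names N = {w. length w = N \<and> parsed \<U> blocks (K N) w}" for N
  have names_words: "names N \<subseteq> words \<U> N" for N
    using parsed_in_lists[of \<U> blocks] blocks_set by (auto simp: names_def words_def)
  have names_card: "real (card (names N)) \<le> v ^ K N * exp (b1 * real N)" for N
    using card_parsed_le[OF finite_cover blocks v kraft] unfolding names_def by blast
  have names_prob: "prob (space M - \<Union>(cell M T ` names N)) < \<epsilon>'" if N: "0 < N" for N
  proof -
    let ?bad = "\<lambda>x. card {i. i < N \<and> (T ^^ i) x \<in> D}"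
    have t: "0 < s * real N" using s N by simp
    have "space M - \<Union>(cell M T ` names N) \<subseteq> {x \<in> space M. s * real N \<le> real (?bad x)}"
    proof
      fix x assume x: "x \<in> space M - \<Union>(cell M T ` names N)"
      have "\<exists>w k r. length w = N \<and> x \<in> cell M T w \<and> parsed \<U> blocks k w \<and>
          k \<le> card {i. i < N \<and> (T ^^ i) x \<notin> R} + L * r + (L + q) \<and> r * p \<le> N"
        unfolding R_def
      proof (rule parse_orbit[OF p])
        show "\<exists>c\<in>blocks. length c = n \<and> y \<in> cell M T c" if "n \<in> {p..q}" "y \<in> B n" for n y
          using that C_length by (auto simp: blocks_def B_def)
      qed (use x in simp)
      moreover have "{i. i < N \<and> (T ^^ i) x \<notin> R} = {i. i < N \<and> (T ^^ i) x \<in> D}"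
        using x T_pow_space by (auto simp: D_def)
      ultimately have "\<exists>w k r. length w = N \<and> x \<in> cell M T w \<and> parsed \<U> blocks k w \<and>
          k \<le> ?bad x + L * r + (L + q) \<and> r * p \<le> N"
        by (simp only:)
      then obtain w k r where w: "length w = N" "x \<in> cell M T w" "parsed \<U> blocks k w"
        "k \<le> ?bad x + L * r + (L + q)" "r * p \<le> N"
        by (elim exE conjE) (rule that)
      have "s * real N \<le> real (?bad x)"
      proof (rule ccontr)
        assume less: "\<not> s * real N \<le> real (?bad x)"
        have "real L * real r \<le> s * real p * real r" using L by (intro mult_right_mono) auto
        also have "\<dots> = s * real (r * p)" by simp
        also have "\<dots> \<le> s * real N" using w(5) s by (intro mult_left_mono) (auto simp flip: of_nat_mult)
        finally have "real (?bad x + L * r) \<le> 2 * s * real N" using less by simp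
        then have "?bad x + L * r \<le> nat \<lfloor>2 * s * real N\<rfloor>" by (simp add: le_nat_floor)
        then have "k \<le> K N" using w(4) by (simp add: K_def)
        then have "w \<in> names N" using w(1,3) parsed_mono by (auto simp: names_def)
        then show False using w(2) x by blast
      qed
      then show "x \<in> {x \<in> space M. s * real N \<le> real (?bad x)}" using x by simp
    qed
    then have "prob (space M - \<Union>(cell M T ` names N)) \<le> prob {x \<in> space M. s * real N \<le> real (?bad x)}"
      by (intro finite_measure_mono prob_frequent_visits_le(1)[OF D_sets t])
    also have "\<dots> \<le> real N * prob D / (s * real N)"
      by (rule prob_frequent_visits_le(2)[OF D_sets t])
    also have "\<dots> < \<epsilon>'" using D_prob s N by (simp add: field_simps)
    finally show ?thesis .
  qed
  have bound: "real (covnum N \<epsilon>') \<le> exp (b * real N)"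
    if N: "0 < N" "real (L + q) * ln v \<le> (b - b1) / 2 * real N" for N
  proof -
    have "real (covnum N \<epsilon>') \<le> real (card (names N))"
      using covnum_le[OF N(1) names_words names_prob[OF N(1)]] by simp
    also have "\<dots> \<le> v ^ K N * exp (b1 * real N)" by (rule names_card)
    also have "v ^ K N = exp (real (K N) * ln v)"
      using v(1) by (simp add: exp_of_nat_mult)
    also have "\<dots> \<le> exp ((b - b1) * real N)"
    proof -
      have "real (K N) \<le> 2 * s * real N + real (L + q)" using s by (simp add: K_def)
      then have "real (K N) * ln v \<le> (2 * s * real N + real (L + q)) * ln v"
        using lnv by (intro mult_right_mono)
      also have "\<dots> = (2 * s * ln v) * real N + real (L + q) * ln v" by (simp add: algebra_simps)
      \<comment> \<open>One half pays for the letters proportional to \<open>N\<close>, the other for the bounded number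
        \<open>L + q\<close>.\<close>
      also have "\<dots> \<le> (b - b1) / 2 * real N + (b - b1) / 2 * real N"
        using s_lnv N(2) by (intro add_mono mult_right_mono) auto
      also have "\<dots> = (b - b1) * real N" by simp
      finally show ?thesis by simp
    qed
    finally show ?thesis by (simp add: algebra_simps flip: exp_add)
  qed
  have "\<forall>\<^sub>F N in sequentially. real (L + q) * ln v \<le> (b - b1) / 2 * real N"
    using gap by real_asymp
  then show ?thesis using eventually_gt_at_top[of 0] by eventually_elim (rule bound)
qed

lemma covnum_rate_convergent:
  "\<exists>h::real. \<forall>\<epsilon>. 0 < \<epsilon> \<and> \<epsilon> < 1 \<longrightarrow> (\<lambda>n. 1 / real n * ln (real (covnum n \<epsilon>))) \<longlonglongrightarrow> h"
proof -
  define r where "r \<epsilon> n = 1 / real n * ln (real (covnum n \<epsilon>))" for \<epsilon> n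
  have r_le: "r \<epsilon> n \<le> a \<longleftrightarrow> real (covnum n \<epsilon>) \<le> exp (a * real n)"
    if "0 < n" "0 < \<epsilon>" "\<epsilon> < 1" for \<epsilon> n a
  proof -
    have "0 < real (covnum n \<epsilon>)" using covnum_ge_1[OF that] by simp
    then have "real (covnum n \<epsilon>) \<le> exp (a * real n) \<longleftrightarrow> ln (real (covnum n \<epsilon>)) \<le> a * real n"
      by (metis ln_exp ln_le_cancel_iff exp_gt_zero)
    then show ?thesis using that by (simp add: r_def field_simps)
  qed
  have jump: "\<forall>\<^sub>F n in sequentially. r \<epsilon>' n \<le> b"
    if "0 < \<epsilon>" "\<epsilon> < 1" "0 < \<epsilon>'" "\<epsilon>' < 1" "a < b" "\<exists>\<^sub>F n in sequentially. r \<epsilon> n \<le> a" for \<epsilon> \<epsilon>' a b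
  proof -
    have "\<exists>\<^sub>F n in sequentially. r \<epsilon> n \<le> a \<and> 0 < n"
      using that(6) eventually_gt_at_top[of 0] by (rule frequently_eventually_frequently)
    then have "\<exists>\<^sub>F n in sequentially. real (covnum n \<epsilon>) \<le> exp (a * real n)"
      by (rule frequently_elim1) (use r_le that in auto)
    from covnum_growth[OF that(1-3) that(5) this] eventually_gt_at_top[of 0]
    show ?thesis by eventually_elim (use r_le that in auto)
  qed
  \<comment> \<open>The infimum of \<open>Z\<close> is the lower limit of the rates for the error \<open>1/2\<close>.\<close>
  define Z where "Z = {a. \<exists>\<^sub>F n in sequentially. r (1/2) n \<le> a}"
  define h where "h = Inf Z"
  have "\<forall>\<^sub>F n in sequentially. r (1/2) n \<le> ln (real (card \<U>))"
    using eventually_gt_at_top[of 0]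
  proof eventually_elim
    case (elim n)
    have "real (covnum n (1/2)) \<le> real (card \<U>) ^ n"
      using covnum_le_power[OF elim, of "1/2"] by (simp flip: of_nat_power)
    also have "\<dots> = exp (ln (real (card \<U>)) * real n)"
      using card_cover_ge_1 by (simp add: exp_of_nat2_mult)
    finally show ?case using r_le elim by simp
  qed
  then have Z_ne: "Z \<noteq> {}" unfolding Z_def by (auto dest: eventually_frequently[rotated])
  have Z_pos: "0 \<le> a" if "a \<in> Z" for a
  proof -
    have "\<exists>\<^sub>F n in sequentially. r (1/2) n \<le> a \<and> 0 < n"
      using that eventually_gt_at_top[of 0] unfolding Z_def by (auto intro: frequently_eventually_frequently)
    then obtain n where n: "r (1/2) n \<le> a" "0 < n" by (auto dest: frequently_ex)
    have "0 \<le> r (1/2) n" using covnum_ge_1[OF n(2), of "1/2"] by (simp add: r_def)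
    with n show ?thesis by simp
  qed
  then have bdd: "bdd_below Z" by (rule bdd_belowI)
  have "r \<epsilon> \<longlonglongrightarrow> h" if \<epsilon>: "0 < \<epsilon>" "\<epsilon> < 1" for \<epsilon>
  proof (rule order_tendstoI)
    fix y assume "y < h"
    define c where "c = (y + h) / 2"
    have c: "y < c" "c < h" using \<open>y < h\<close> by (auto simp: c_def)
    show "\<forall>\<^sub>F n in sequentially. y < r \<epsilon> n"
    proof (rule ccontr)
      assume "\<not> ?thesis"
      then have "\<exists>\<^sub>F n in sequentially. r \<epsilon> n \<le> y" by (simp add: frequently_def not_le)
      then have "\<forall>\<^sub>F n in sequentially. r (1/2) n \<le> c" using \<epsilon> c(1) by (intro jump) auto
      then have "c \<in> Z" unfolding Z_def by (auto dest: eventually_frequently[rotated])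
      then show False using c(2) cInf_lower[OF _ bdd] unfolding h_def by force
    qed
  next
    fix y assume "h < y"
    then obtain a where a: "a \<in> Z" "a < y" using cInf_lessD[OF Z_ne] unfolding h_def by blast
    then have "\<forall>\<^sub>F n in sequentially. r \<epsilon> n \<le> (a + y) / 2"
      using \<epsilon> unfolding Z_def by (intro jump[of "1/2" \<epsilon> a]) auto
    then show "\<forall>\<^sub>F n in sequentially. r \<epsilon> n < y" by eventually_elim (use a(2) in simp)
  qed
  then show ?thesis unfolding r_def by blast
qed

end

theorem theorem4p2:
  fixes M :: "'a measure" and T :: "'a \<Rightarrow> 'a" and \<U> :: "'a set set"
  assumes "ergodic_mt_dynamical_system M T"
    and "is_cover M \<U>"
  shows "\<exists>h::real. \<forall>\<epsilon>::real. 0 < \<epsilon> \<and> \<epsilon> < 1 \<longrightarrow>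
           (\<lambda>n. 1 / real n * ln (real (cover_number M (iterated_join M T \<U> (n - 1)) \<epsilon>))) \<longlonglongrightarrow> h"
proof -
  interpret ergodic_mt_dynamical_system M T by fact
  interpret covered_ergodic_system M T \<U> by unfold_locales fact
  show ?thesis by (rule covnum_rate_convergent)
qed

end
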